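(* Let $\mathcal{B}$ be a boolean $\mathcal{C}$-algebra. Then $\mathcal{B}$ is weakly equationally Noetherian if and only if the algebra $\mathcal{C}$ is complete in $\mathcal{B}$, i.e. any set of elements $\{\mathbf{c}_j\mid j\in J\}\subseteq\mathcal{C}$ has an infimum in the algebra $\mathcal{B}$ and this infimum belongs to $\mathcal{C}$.
   Context: Language. Let $\mathcal{L}=\{\vee,\cdot,\bar{\ },0,1\}\cup\{\mathbf{c}_i\mid i\in I\}$ be the language of boolean algebras (disjunction, conjunction, negation, $0$, $1$) extended by an arbitrary (possibly infinite) set of constant symbols. A boolean $\mathcal{C}$-algebra is a boolean algebra $\mathcal{B}$ regarded as a structure of the language $\mathcal{L}$, where $\mathcal{C}\subseteq\mathcal{B}$ denotes the boolean subalgebra generated by (the interpretations of) the constants $\mathbf{c}_i$, $i\in I$. The partial order on $\mathcal{B}$ is $x\le y\iff xy=x$; infima are taken with respect to it. Equations. For a finite set of variables $X=\{x_1,\dots,x_n\}$, an equation over $\mathcal{B}$ is an atomic formula $\tau(X)=\sigma(X)$, where $\tau,\sigma$ are $\mathcal{L}$-terms in $X$. A system is an arbitrary (possibly infinite) set of equations in a common finite set of variables. Two systems in variables $X$ are equivalent over $\mathcal{B}$ if they have the same solution set in $\mathcal{B}^n$. Weakly equationally Noetherian. $\mathcal{B}$ is weakly equationally Noetherian if for every system $\mathcal{S}$ there exists a finite system $\mathcal{S}'$ (in the same variables, not necessarily a subsystem of $\mathcal{S}$) equivalent to $\mathcal{S}$ over $\mathcal{B}$. *)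

theory Defs
  imports "HOL-Library.FuncSet" "HOL-Library.Lub_Glb"
begin

text \<open>
  Throughout, the algebra \<open>B\<close> is a type \<open>'a\<close> of class \<^class>\<open>boolean_algebra\<close>, with conjunction
  \<^term>\<open>inf\<close>, disjunction \<^term>\<open>sup\<close> and negation \<^term>\<open>uminus\<close>. The constant symbols are indexed
  by a set \<open>I\<close> (possibly empty or infinite); \<open>c i\<close> interprets the symbol with index \<open>i\<close>, and the
  values of \<open>c\<close> outside \<open>I\<close> are never used.
\<close>

datatype (const_set: 'i, var_set: 'v) bool_term =
    Var 'v
  | Const 'i
  | Zero
  | One
  | Neg "('i, 'v) bool_term"
  | Conj "('i, 'v) bool_term" "('i, 'v) bool_term"
  | Disj "('i, 'v) bool_term" "('i, 'v) bool_term"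

primrec eval :: "('i \<Rightarrow> 'a::boolean_algebra) \<Rightarrow> ('v \<Rightarrow> 'a) \<Rightarrow> ('i, 'v) bool_term \<Rightarrow> 'a" where
  "eval c p (Var v) = p v"
| "eval c p (Const i) = c i"
| "eval c p Zero = bot"
| "eval c p One = top"
| "eval c p (Neg t) = - eval c p t"
| "eval c p (Conj s t) = inf (eval c p s) (eval c p t)"
| "eval c p (Disj s t) = sup (eval c p s) (eval c p t)"

type_synonym ('i, 'v) equation = "('i, 'v) bool_term \<times> ('i, 'v) bool_term"

text \<open>The variables \<open>x\<^sub>1, \<dots>, x\<^sub>n\<close> are represented by the numbers \<open>0, \<dots>, n - 1\<close>.\<close>

definition terms_in :: "'i set \<Rightarrow> nat \<Rightarrow> ('i, nat) bool_term set" where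
  "terms_in I n = {t. const_set t \<subseteq> I \<and> var_set t \<subseteq> {..<n}}"

definition is_system :: "'i set \<Rightarrow> nat \<Rightarrow> ('i, nat) equation set \<Rightarrow> bool" where
  "is_system I n S \<longleftrightarrow> S \<subseteq> terms_in I n \<times> terms_in I n"

text \<open>The points of \<open>B\<^sup>n\<close> are the functions on \<open>{..<n}\<close>, made extensional.\<close>

definition solutions ::
    "('i \<Rightarrow> 'a::boolean_algebra) \<Rightarrow> nat \<Rightarrow> ('i, nat) equation set \<Rightarrow> (nat \<Rightarrow> 'a) set" where
  "solutions c n S =
     {p \<in> {..<n} \<rightarrow>\<^sub>E UNIV. \<forall>(s, t) \<in> S. eval c p s = eval c p t}"

definition weakly_equationally_noetherian :: "'i set \<Rightarrow> ('i \<Rightarrow> 'a::boolean_algebra) \<Rightarrow> bool" where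
  "weakly_equationally_noetherian I c \<longleftrightarrow>
     (\<forall>n S. is_system I n S \<longrightarrow>
        (\<exists>S'. is_system I n S' \<and> finite S' \<and> solutions c n S' = solutions c n S))"

inductive_set subalgebra_gen :: "'a::boolean_algebra set \<Rightarrow> 'a set" for A where
  gen: "a \<in> A \<Longrightarrow> a \<in> subalgebra_gen A"
| bot: "bot \<in> subalgebra_gen A"
| top: "top \<in> subalgebra_gen A"
| compl: "a \<in> subalgebra_gen A \<Longrightarrow> - a \<in> subalgebra_gen A"
| inf: "a \<in> subalgebra_gen A \<Longrightarrow> b \<in> subalgebra_gen A \<Longrightarrow> inf a b \<in> subalgebra_gen A"
| sup: "a \<in> subalgebra_gen A \<Longrightarrow> b \<in> subalgebra_gen A \<Longrightarrow> sup a b \<in> subalgebra_gen A"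

text \<open>The infimum is taken in the whole algebra \<open>B\<close>, not just among the elements of \<open>C\<close>.\<close>

definition complete_in_algebra :: "'a::boolean_algebra set \<Rightarrow> bool" where
  "complete_in_algebra C \<longleftrightarrow> (\<forall>A \<subseteq> C. \<exists>m \<in> C. isGlb UNIV A m)"

end

theory Submission
  imports Defs
begin

text \<open>
  By the Shannon expansion, an equation \<open>s = t\<close> in \<open>n\<close> variables holds at a point iff each of the
  \<open>2\<^sup>n\<close> minterms lies below an element of \<open>C\<close>, namely the value of \<open>s \<leftrightarrow> t\<close> at the 0/1-point
  belonging to that minterm. Hence a system amounts to finitely many conditions: every minterm is a
  lower bound of a certain subset of \<open>C\<close>. If the infima of these subsets exist and lie in \<open>C\<close>, they
  yield a finite equivalent system. Conversely, the lower bounds of a subset of \<open>C\<close> form the solution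
  set of a system in one variable; a finite equivalent system describes them as the lower bounds
  of a finite subset of \<open>C\<close>, which has an infimum in \<open>C\<close>.
\<close>

section \<open>Biconditional, infima and closed terms\<close>

definition bool_iff :: "'a::boolean_algebra \<Rightarrow> 'a \<Rightarrow> 'a" where
  "bool_iff x y = sup (inf x y) (inf (- x) (- y))"

text \<open>Agreement of two elements below \<open>z\<close> becomes an upper bound on
  \<open>z\<close> that does not itself depend on \<open>z\<close>. All later passages between
  equations and inequalities use this.\<close>

lemma le_bool_iff: "z \<le> bool_iff x y \<longleftrightarrow> inf z x = inf z (y::'a::boolean_algebra)"
proof
  assume le: "z \<le> bool_iff x y"
  have "inf (bool_iff x y) x = inf (bool_iff x y) y"
    by (simp add: bool_iff_def inf_sup_distrib1 inf_sup_distrib2 inf_commute inf_left_commute)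
  with le show "inf z x = inf z y"
    by (metis inf.absorb1 inf.assoc)
next
  assume eq: "inf z x = inf z y"
  \<comment> \<open>The part of \<open>- x\<close> below \<open>z\<close> depends only on the part
    of \<open>x\<close> below \<open>z\<close>, so \<open>eq\<close> carries over to
    complements.\<close>
  have "inf z (- x) = inf z (- inf z x)" "inf z (- y) = inf z (- inf z y)"
    by (simp_all add: inf_sup_distrib1)
  with eq have eq': "inf z (- x) = inf z (- y)"
    by simp
  have "z = sup (inf z x) (inf z (- x))"
    by (simp flip: inf_sup_distrib1)
  also have "\<dots> \<le> bool_iff x y"
    unfolding bool_iff_def
    using eq eq' by (intro sup_mono le_infI) (metis inf.cobounded2)+
  finally show "z \<le> bool_iff x y" .
qed

lemma isGlb_UNIV_iff:
  "isGlb UNIV A m \<longleftrightarrow> (\<forall>x. x \<le> m \<longleftrightarrow> (\<forall>a\<in>A. x \<le> a))" for m :: "'a::order"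
  by (simp add: isGlb_def greatestP_def isLb_def setge_def setle_def) (meson order_refl order_trans)

lemma subalgebra_gen_bool_iff:
  "x \<in> subalgebra_gen A \<Longrightarrow> y \<in> subalgebra_gen A \<Longrightarrow> bool_iff x y \<in> subalgebra_gen A"
  by (simp add: bool_iff_def subalgebra_gen.compl subalgebra_gen.inf subalgebra_gen.sup)

lemma subalgebra_gen_finite_glb:
  assumes "finite F" "F \<subseteq> subalgebra_gen A"
  shows "\<exists>m\<in>subalgebra_gen A. \<forall>x. x \<le> m \<longleftrightarrow> (\<forall>a\<in>F. x \<le> a)"
  using assms
proof (induction F rule: finite_induct)
  case empty
  show ?case using subalgebra_gen.top by force
next
  case (insert a F)
  then obtain m where "m \<in> subalgebra_gen A" "\<forall>x. x \<le> m \<longleftrightarrow> (\<forall>a\<in>F. x \<le> a)"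
    by auto
  then show ?case
    using insert.prems by (intro bexI[of _ "inf a m"]) (auto intro: subalgebra_gen.inf)
qed

lemma eval_in_subalgebra_gen:
  assumes "const_set t \<subseteq> I" "\<And>v. v \<in> var_set t \<Longrightarrow> p v \<in> subalgebra_gen (c ` I)"
  shows "eval c p t \<in> subalgebra_gen (c ` I)"
  using assms by (induction t) (simp_all add: subalgebra_gen.intros)

text \<open>Closed terms name all elements of the generated subalgebra, so equations may use any of
  them as a coefficient.\<close>

lemma subalgebra_gen_eq_eval:
  fixes c :: "'i \<Rightarrow> 'a::boolean_algebra"
  assumes "a \<in> subalgebra_gen (c ` I)"
  shows "\<exists>t :: ('i, 'v) bool_term. const_set t \<subseteq> I \<and> var_set t = {} \<and> (\<forall>p. eval c p t = a)"
  using assms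
proof induction
  case (gen a)
  then obtain i where "i \<in> I" "a = c i" by auto
  then show ?case by (intro exI[of _ "Const i"]) auto
next
  case bot
  show ?case by (intro exI[of _ Zero]) auto
next
  case top
  show ?case by (intro exI[of _ One]) auto
next
  case (compl a)
  then obtain t :: "('i, 'v) bool_term"
    where "const_set t \<subseteq> I" "var_set t = {}" "\<forall>p. eval c p t = a"
    by (elim exE conjE)
  then show ?case by (intro exI[of _ "Neg t"]) auto
next
  case (inf a b)
  then obtain s t :: "('i, 'v) bool_term"
    where "const_set s \<subseteq> I" "var_set s = {}" "\<forall>p. eval c p s = a"
      and "const_set t \<subseteq> I" "var_set t = {}" "\<forall>p. eval c p t = b"
    by (elim exE conjE)
  then show ?case by (intro exI[of _ "Conj s t"]) auto
next
  case (sup a b)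
  then obtain s t :: "('i, 'v) bool_term"
    where "const_set s \<subseteq> I" "var_set s = {}" "\<forall>p. eval c p s = a"
      and "const_set t \<subseteq> I" "var_set t = {}" "\<forall>p. eval c p t = b"
    by (elim exE conjE)
  then show ?case by (intro exI[of _ "Disj s t"]) auto
qed

section \<open>Minterms and the Shannon expansion\<close>

primrec minterm :: "nat \<Rightarrow> nat set \<Rightarrow> ('i, nat) bool_term" where
  "minterm 0 E = One"
| "minterm (Suc n) E = Conj (minterm n E) (if n \<in> E then Var n else Neg (Var n))"

definition vertex :: "nat set \<Rightarrow> nat \<Rightarrow> 'a::boolean_algebra" where
  "vertex E v = (if v \<in> E then top else bot)"

lemma const_set_minterm: "const_set (minterm n E) = {}"
  by (induction n) simp_all

lemma var_set_minterm: "var_set (minterm n E) = {..<n}"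
  by (induction n) (simp_all add: lessThan_Suc)

lemma eval_minterm_cong:
  "(\<And>v. v < n \<Longrightarrow> v \<in> E \<longleftrightarrow> v \<in> E') \<Longrightarrow> eval c p (minterm n E) = eval c p (minterm n E')"
  by (induction n) simp_all

lemma minterm_le_literal:
  "v < n \<Longrightarrow> eval c p (minterm n E) \<le> (if v \<in> E then p v else - p v)"
  by (induction n) (auto simp: less_Suc_eq intro: le_infI1)

text \<open>Below the minterm of \<open>E\<close> every variable agrees with its value at
  \<open>vertex E\<close>, and agreement below a fixed element is a congruence for the boolean
  operations.\<close>

lemma inf_minterm_eval:
  assumes "var_set t \<subseteq> {..<n}"
  shows "inf (eval c p (minterm n E)) (eval c p t) = inf (eval c p (minterm n E)) (eval c (vertex E) t)"
proof -
  define m where "m = eval c p (minterm n E)"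
  \<comment> \<open>Stated through \<open>bool_iff\<close>, the negation case is immediate:
    \<open>bool_iff\<close> does not change when both arguments are complemented.\<close>
  have "m \<le> bool_iff (eval c p t) (eval c (vertex E) t)"
    using assms
  proof (induction t)
    case (Var v)
    then show ?case
      using minterm_le_literal[of v n c p E]
      by (auto simp: m_def vertex_def bool_iff_def split: if_splits)
  next
    case (Neg t)
    then show ?case by (simp add: bool_iff_def sup_commute)
  next
    case (Conj s t)
    then have s: "inf m (eval c p s) = inf m (eval c (vertex E) s)"
      and t: "inf m (eval c p t) = inf m (eval c (vertex E) t)"
      by (simp_all add: le_bool_iff)
    have "inf m (inf (eval c p s) (eval c p t)) = inf (eval c (vertex E) s) (inf m (eval c p t))"
      by (simp add: s inf.left_commute flip: inf.assoc)
    then show ?case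
      by (simp add: le_bool_iff t inf.left_commute)
  next
    case (Disj s t)
    then show ?case
      by (auto simp: le_bool_iff inf_sup_distrib1)
  qed (auto simp: le_bool_iff)
  then show ?thesis
    by (simp add: le_bool_iff m_def)
qed

text \<open>The minterms cover \<open>top\<close>. No finite join is needed: a minterm in
  \<open>n\<close> variables is the join of its two extensions by a literal in variable
  \<open>n\<close>.\<close>

lemma eq_if_inf_minterms_eq:
  assumes "\<And>E. E \<subseteq> {..<n} \<Longrightarrow> inf (eval c p (minterm n E)) x = inf (eval c p (minterm n E)) y"
  shows "x = y"
  using assms
proof (induction n)
  case 0
  then show ?case by simp
next
  case (Suc n)
  show ?case
  proof (rule Suc.IH)
    fix E :: "nat set"
    assume E: "E \<subseteq> {..<n}"
    let ?m = "eval c p (minterm n E)"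
    \<comment> \<open>\<open>minterm n\<close> ignores elements of its set from \<open>n\<close> on,
      so \<open>E\<close> and \<open>insert n E\<close> give the two extensions of the same
      \<open>?m\<close>.\<close>
    have "eval c p (minterm n (insert n E)) = ?m"
      by (rule eval_minterm_cong) auto
    moreover have "n \<notin> E" "E \<subseteq> {..<Suc n}" "insert n E \<subseteq> {..<Suc n}"
      using E by auto
    ultimately have "inf ?m (p n) \<le> bool_iff x y" "inf ?m (- p n) \<le> bool_iff x y"
      using Suc.prems[of E] Suc.prems[of "insert n E"] by (simp_all add: le_bool_iff)
    then have "sup (inf ?m (p n)) (inf ?m (- p n)) \<le> bool_iff x y"
      by simp
    then have "?m \<le> bool_iff x y"
      by (simp flip: inf_sup_distrib1)
    then show "inf ?m x = inf ?m y"
      by (simp add: le_bool_iff)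
  qed
qed

section \<open>Systems as upper bounds on minterms\<close>

definition vertex_coeffs ::
    "('i \<Rightarrow> 'a::boolean_algebra) \<Rightarrow> ('i, nat) equation set \<Rightarrow> nat set \<Rightarrow> 'a set" where
  "vertex_coeffs c S E = (\<lambda>(s, t). bool_iff (eval c (vertex E) s) (eval c (vertex E) t)) ` S"

text \<open>At a vertex the variables only take the values \<open>top\<close> and
  \<open>bot\<close>, so the constants alone generate the value of a term.\<close>

lemma vertex_coeffs_subset:
  assumes "is_system I n S"
  shows "vertex_coeffs c S E \<subseteq> subalgebra_gen (c ` I)"
proof -
  have "eval c (vertex E) t \<in> subalgebra_gen (c ` I)" if "t \<in> terms_in I n" for t
    using that
    by (intro eval_in_subalgebra_gen) (auto simp: terms_in_def vertex_def intro: subalgebra_gen.intros)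
  then show ?thesis
    using assms by (auto simp: vertex_coeffs_def is_system_def intro!: subalgebra_gen_bool_iff)
qed

text \<open>Each equation is tested below every minterm, where its terms may be evaluated at the
  vertex instead of at \<open>p\<close>. The resulting bounds are independent of
  \<open>p\<close>.\<close>

lemma solutions_iff_minterms:
  assumes "is_system I n S"
  shows "p \<in> solutions c n S \<longleftrightarrow> p \<in> {..<n} \<rightarrow>\<^sub>E UNIV \<and>
    (\<forall>E \<subseteq> {..<n}. \<forall>a \<in> vertex_coeffs c S E. eval c p (minterm n E) \<le> a)"
proof -
  have eq_iff: "eval c p s = eval c p t \<longleftrightarrow> (\<forall>E \<subseteq> {..<n}.
      eval c p (minterm n E) \<le> bool_iff (eval c (vertex E) s) (eval c (vertex E) t))"
    if "(s, t) \<in> S" for s t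
  proof -
    have vars: "var_set s \<subseteq> {..<n}" "var_set t \<subseteq> {..<n}"
      using that assms by (auto simp: is_system_def terms_in_def)
    have "eval c p s = eval c p t \<longleftrightarrow> (\<forall>E \<subseteq> {..<n}.
        inf (eval c p (minterm n E)) (eval c p s) = inf (eval c p (minterm n E)) (eval c p t))"
      by (rule iffI) (simp, rule eq_if_inf_minterms_eq, blast)
    then show ?thesis
      by (simp add: le_bool_iff inf_minterm_eval[OF vars(1)] inf_minterm_eval[OF vars(2)])
  qed
  have "(\<forall>(s, t)\<in>S. eval c p s = eval c p t) \<longleftrightarrow> (\<forall>(s, t)\<in>S. \<forall>E \<subseteq> {..<n}.
      eval c p (minterm n E) \<le> bool_iff (eval c (vertex E) s) (eval c (vertex E) t))"
    by (intro ball_cong refl) (simp add: eq_iff split_beta)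
  also have "\<dots> \<longleftrightarrow> (\<forall>E \<subseteq> {..<n}. \<forall>a\<in>vertex_coeffs c S E. eval c p (minterm n E) \<le> a)"
    by (simp add: vertex_coeffs_def split_beta) blast
  finally show ?thesis
    by (simp only: solutions_def mem_Collect_eq)
qed

section \<open>Finite equivalent systems and infima\<close>

lemma complete_if_weakly_equationally_noetherian:
  fixes I :: "'i set" and c :: "'i \<Rightarrow> 'a::boolean_algebra"
  assumes "weakly_equationally_noetherian I c"
  shows "complete_in_algebra (subalgebra_gen (c ` I))"
  unfolding complete_in_algebra_def
proof (intro allI impI)
  let ?C = "subalgebra_gen (c ` I)"
  fix A
  assume A: "A \<subseteq> ?C"
  then have "\<forall>a\<in>A. \<exists>t :: ('i, nat) bool_term. const_set t \<subseteq> I \<and> var_set t = {} \<and> (\<forall>p. eval c p t = a)"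
    by (intro ballI subalgebra_gen_eq_eval) auto
  from bchoice[OF this] obtain u :: "'a \<Rightarrow> ('i, nat) bool_term" where
    u: "\<And>a. a \<in> A \<Longrightarrow> const_set (u a) \<subseteq> I" "\<And>a. a \<in> A \<Longrightarrow> var_set (u a) = {}"
      "\<And>a p. a \<in> A \<Longrightarrow> eval c p (u a) = a"
    by blast
  \<comment> \<open>The equation for \<open>a\<close> expresses that the variable lies below
    \<open>a\<close>.\<close>
  define S :: "('i, nat) equation set" where "S = (\<lambda>a. (Conj (Var 0) (u a), Var 0)) ` A"
  have "is_system I 1 S"
    by (auto simp: S_def is_system_def terms_in_def u(2) dest: subsetD[OF u(1)])
  then obtain S' where S': "is_system I 1 S'" "finite S'" "solutions c 1 S' = solutions c 1 S"
    using assms unfolding weakly_equationally_noetherian_def by blast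
  define pt where "pt x = (\<lambda>v::nat\<in>{..<1}. x)" for x :: 'a
  have sol_S: "pt x \<in> solutions c 1 S \<longleftrightarrow> (\<forall>a\<in>A. x \<le> a)" for x
    by (simp add: solutions_def S_def pt_def le_iff_inf u(3))
  have subsets: "(\<forall>E \<subseteq> {..<1::nat}. P E) \<longleftrightarrow> P {} \<and> P {0}" for P
    by (auto simp: lessThan_Suc subset_singleton_iff)
  have sol_S': "pt x \<in> solutions c 1 S' \<longleftrightarrow>
      (\<forall>a\<in>vertex_coeffs c S' {}. - x \<le> a) \<and> (\<forall>a\<in>vertex_coeffs c S' {0}. x \<le> a)" for x
    unfolding solutions_iff_minterms[OF S'(1)] subsets by (simp add: pt_def)
  \<comment> \<open>The bounds on \<open>- x\<close> must be shown vacuous. As \<open>bot\<close> is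
    a lower bound of \<open>A\<close>, it solves \<open>S'\<close>, and its complement
    \<open>top\<close> then lies below each of them.\<close>
  have "pt bot \<in> solutions c 1 S"
    unfolding sol_S by simp
  then have "\<forall>a\<in>vertex_coeffs c S' {}. a = top"
    using sol_S'[of bot] S'(3) by (simp add: top_unique)
  then have lower: "(\<forall>a\<in>A. x \<le> a) \<longleftrightarrow> (\<forall>a\<in>vertex_coeffs c S' {0}. x \<le> a)" for x
    using sol_S[of x] sol_S'[of x] S'(3) by auto
  have "finite (vertex_coeffs c S' {0})"
    using S'(2) by (simp add: vertex_coeffs_def)
  from subalgebra_gen_finite_glb[OF this vertex_coeffs_subset[OF S'(1)]]
  show "\<exists>m\<in>?C. isGlb UNIV A m"
    by (simp add: isGlb_UNIV_iff lower)
qed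

lemma weakly_equationally_noetherian_if_complete:
  fixes I :: "'i set" and c :: "'i \<Rightarrow> 'a::boolean_algebra"
  assumes "complete_in_algebra (subalgebra_gen (c ` I))"
  shows "weakly_equationally_noetherian I c"
  unfolding weakly_equationally_noetherian_def
proof (intro allI impI)
  fix n and S :: "('i, nat) equation set"
  assume S: "is_system I n S"
  have "\<forall>E. \<exists>m. m \<in> subalgebra_gen (c ` I) \<and> isGlb UNIV (vertex_coeffs c S E) m"
    using assms vertex_coeffs_subset[OF S] unfolding complete_in_algebra_def by blast
  from choice[OF this] obtain m where
    m: "m E \<in> subalgebra_gen (c ` I)" "isGlb UNIV (vertex_coeffs c S E) (m E)" for E
    by blast
  have "\<forall>E. \<exists>t :: ('i, nat) bool_term. const_set t \<subseteq> I \<and> var_set t = {} \<and> (\<forall>p. eval c p t = m E)"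
    by (intro allI subalgebra_gen_eq_eval m)
  from choice[OF this] obtain u :: "nat set \<Rightarrow> ('i, nat) bool_term" where
    u: "\<And>E. const_set (u E) \<subseteq> I" "\<And>E. var_set (u E) = {}" "\<And>E p. eval c p (u E) = m E"
    by blast
  \<comment> \<open>One equation per minterm, placing it below the infimum \<open>m E\<close> of all
    its bounds; there are only finitely many minterms, however large \<open>S\<close> is.\<close>
  define S' :: "('i, nat) equation set" where "S' = (\<lambda>E. (Conj (minterm n E) (u E), minterm n E)) ` Pow {..<n}"
  have "is_system I n S'"
    by (auto simp: S'_def is_system_def terms_in_def const_set_minterm var_set_minterm
        dest: subsetD[OF u(1)] simp: u(2))
  moreover have "finite S'"
    by (simp add: S'_def)
  moreover have "p \<in> solutions c n S' \<longleftrightarrow> p \<in> solutions c n S" for p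
  proof -
    have "p \<in> solutions c n S' \<longleftrightarrow> p \<in> {..<n} \<rightarrow>\<^sub>E UNIV \<and>
        (\<forall>E \<subseteq> {..<n}. eval c p (minterm n E) \<le> eval c p (u E))"
      by (auto simp: solutions_def S'_def le_iff_inf)
    then show ?thesis
      using m(2) by (simp add: solutions_iff_minterms[OF S] u(3) isGlb_UNIV_iff)
  qed
  ultimately show "\<exists>S'. is_system I n S' \<and> finite S' \<and> solutions c n S' = solutions c n S"
    by blast
qed

theorem theorem5p1:
  fixes I :: "'i set" and c :: "'i \<Rightarrow> 'a::boolean_algebra"
  shows "weakly_equationally_noetherian I c \<longleftrightarrow> complete_in_algebra (subalgebra_gen (c ` I))"
  by (rule iffI)
    (rule complete_if_weakly_equationally_noetherian weakly_equationally_noetherian_if_complete, assumption)+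

end
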